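(* Let $\Gamma$ be a group. Then the set of normal subgroups $H\subset\Gamma$ such that the quotient $\Gamma/H$ is a post-injunctive group is closed in $\mathcal{N}(\Gamma)$, the space of normal subgroups of $\Gamma$.
   Context: For a group $G$ and a set $A$ (the alphabet), $A^G$ is the set of all maps $x\colon G\to A$ (configurations), with shift action $(gx)(h)=x(g^{-1}h)$. A cellular automaton $\tau\colon A^G\to A^G$ is a map for which there exist a finite subset $M\subset G$ (a memory set) and a map $\mu\colon A^M\to A$ (the local transition map) such that $\tau(x)(g)=\mu((g^{-1}x)|_M)$ for all $x\in A^G$, $g\in G$. Two configurations $x,y\in A^G$ are asymptotic if $x|_{G\setminus E}=y|_{G\setminus E}$ for some finite $E\subset G$. The cellular automaton $\tau$ is pre-injective if for all asymptotic $x,y\in A^G$, $\tau(x)=\tau(y)$ implies $x=y$. It is post-surjective if for all $x,y\in A^G$ with $y$ asymptotic to $\tau(x)$, there exists $z\in A^G$ asymptotic to $x$ with $\tau(z)=y$. A group $G$ is post-injunctive if for every finite alphabet $A$, every post-surjective cellular automaton $\tau\colon A^G\to A^G$ is pre-injective. Topology on $\mathcal{N}(\Gamma)$: the set $\mathcal{N}(\Gamma)$ of normal subgroups of $\Gamma$ is viewed as a subspace of $\{0,1\}^\Gamma$ (product of discrete spaces) via indicator functions; a base of neighborhoods of $H$ is given by the sets $\{K\in\mathcal{N}(\Gamma)\colon K\cap E=H\cap E\}$, with $E\subset\Gamma$ finite. *)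

theory Defs
  imports "HOL-Algebra.Coset" "HOL-Analysis.Function_Topology"
begin

section \<open>Configurations and cellular automata\<close>

text \<open>
  A configuration over a group \<^term>\<open>G\<close> with alphabet \<^term>\<open>A\<close> is an element of
  \<^term>\<open>carrier G \<rightarrow>\<^sub>E A\<close>, i.e. a map that is \<^term>\<open>undefined\<close> outside the carrier, so that
  equality of configurations is equality of functions.
\<close>

definition configs :: "('g, 'm) monoid_scheme \<Rightarrow> 'c set \<Rightarrow> ('g \<Rightarrow> 'c) set" where
  "configs G A = carrier G \<rightarrow>\<^sub>E A"

definition shift :: "('g, 'm) monoid_scheme \<Rightarrow> 'g \<Rightarrow> ('g \<Rightarrow> 'c) \<Rightarrow> ('g \<Rightarrow> 'c)" where
  "shift G g x = (\<lambda>h\<in>carrier G. x (inv\<^bsub>G\<^esub> g \<otimes>\<^bsub>G\<^esub> h))"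

text \<open>Only the values of the map \<^term>\<open>\<tau>\<close> on \<^term>\<open>configs G A\<close> are relevant below.\<close>

definition cellular_automaton ::
    "('g, 'm) monoid_scheme \<Rightarrow> 'c set \<Rightarrow> (('g \<Rightarrow> 'c) \<Rightarrow> ('g \<Rightarrow> 'c)) \<Rightarrow> bool" where
  "cellular_automaton G A \<tau> \<longleftrightarrow>
     \<tau> \<in> configs G A \<rightarrow> configs G A \<and>
     (\<exists>M \<mu>. finite M \<and> M \<subseteq> carrier G \<and> \<mu> \<in> (M \<rightarrow>\<^sub>E A) \<rightarrow> A \<and>
        (\<forall>x\<in>configs G A. \<forall>g\<in>carrier G. \<tau> x g = \<mu> (restrict (shift G (inv\<^bsub>G\<^esub> g) x) M)))"

definition asymptotic :: "('g, 'm) monoid_scheme \<Rightarrow> ('g \<Rightarrow> 'c) \<Rightarrow> ('g \<Rightarrow> 'c) \<Rightarrow> bool" where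
  "asymptotic G x y \<longleftrightarrow>
     (\<exists>E. finite E \<and> E \<subseteq> carrier G \<and> restrict x (carrier G - E) = restrict y (carrier G - E))"

definition pre_injective ::
    "('g, 'm) monoid_scheme \<Rightarrow> 'c set \<Rightarrow> (('g \<Rightarrow> 'c) \<Rightarrow> ('g \<Rightarrow> 'c)) \<Rightarrow> bool" where
  "pre_injective G A \<tau> \<longleftrightarrow>
     (\<forall>x\<in>configs G A. \<forall>y\<in>configs G A. asymptotic G x y \<longrightarrow> \<tau> x = \<tau> y \<longrightarrow> x = y)"

definition post_surjective ::
    "('g, 'm) monoid_scheme \<Rightarrow> 'c set \<Rightarrow> (('g \<Rightarrow> 'c) \<Rightarrow> ('g \<Rightarrow> 'c)) \<Rightarrow> bool" where
  "post_surjective G A \<tau> \<longleftrightarrow>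
     (\<forall>x\<in>configs G A. \<forall>y\<in>configs G A. asymptotic G y (\<tau> x) \<longrightarrow>
        (\<exists>z\<in>configs G A. asymptotic G z x \<and> \<tau> z = y))"

text \<open>
  A HOL definition cannot quantify over the type of the alphabet. The alphabets range over the
  finite sets of natural numbers; lemma \<open>post_injunctiveD\<close> below shows that this covers the finite
  subsets of every type.
\<close>

definition post_injunctive :: "('g, 'm) monoid_scheme \<Rightarrow> bool" where
  "post_injunctive G \<longleftrightarrow>
     (\<forall>(A :: nat set) \<tau>. finite A \<longrightarrow> cellular_automaton G A \<tau> \<longrightarrow>
        post_surjective G A \<tau> \<longrightarrow> pre_injective G A \<tau>)"

lemma post_injunctiveD:
  fixes G :: "('g, 'm) monoid_scheme" and A :: "'c set"
  assumes G: "group G" and pi: "post_injunctive G" and fin: "finite A"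
    and ca: "cellular_automaton G A \<tau>" and ps: "post_surjective G A \<tau>"
  shows "pre_injective G A \<tau>"
proof -
  interpret group G by (rule G)
  obtain f where f: "bij_betw f A {0..<card A}"
    using ex_bij_betw_finite_nat[OF fin] by blast
  define B where "B = {0..<card A}"
  define k where "k = inv_into A f"
  have fB: "f a \<in> B" and kf: "k (f a) = a" if "a \<in> A" for a
    using f that by (auto simp: B_def k_def bij_betw_def)
  have kA: "k b \<in> A" and fk: "f (k b) = b" if "b \<in> B" for b
    using f that by (auto simp: B_def k_def bij_betw_def inv_into_into f_inv_into_f)
  define F where "F x = (\<lambda>h\<in>carrier G. f (x h))" for x :: "'g \<Rightarrow> 'c"
  define K where "K y = (\<lambda>h\<in>carrier G. k (y h))" for y :: "'g \<Rightarrow> nat"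
  have FB: "F x \<in> configs G B" if "x \<in> configs G A" for x
    using that fB by (auto simp: F_def configs_def)
  have KA: "K y \<in> configs G A" if "y \<in> configs G B" for y
    using that kA by (auto simp: K_def configs_def)
  have KF: "K (F x) = x" if "x \<in> configs G A" for x
    using that kf by (auto simp: F_def K_def configs_def fun_eq_iff PiE_def extensional_def)
  have FK: "F (K y) = y" if "y \<in> configs G B" for y
    using that fk by (auto simp: F_def K_def configs_def fun_eq_iff PiE_def extensional_def)
  have asF: "asymptotic G (F x) (F x')" if "asymptotic G x x'" for x x'
    using that unfolding asymptotic_def F_def restrict_def fun_eq_iff by (smt (verit) DiffD1)
  have asK: "asymptotic G (K x) (K x')" if "asymptotic G x x'" for x x'
    using that unfolding asymptotic_def K_def restrict_def fun_eq_iff by (smt (verit) DiffD1)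
  define \<sigma> where "\<sigma> y = F (\<tau> (K y))" for y
  have \<tau>: "\<tau> x \<in> configs G A" if "x \<in> configs G A" for x
    using ca that by (auto simp: cellular_automaton_def)
  obtain M \<mu> where M: "finite M" "M \<subseteq> carrier G" and \<mu>: "\<mu> \<in> (M \<rightarrow>\<^sub>E A) \<rightarrow> A"
    and loc: "\<And>x g. x \<in> configs G A \<Longrightarrow> g \<in> carrier G \<Longrightarrow>
                \<tau> x g = \<mu> (restrict (shift G (inv\<^bsub>G\<^esub> g) x) M)"
    using ca unfolding cellular_automaton_def by blast
  define \<nu> where "\<nu> p = f (\<mu> (\<lambda>m\<in>M. k (p m)))" for p
  have "cellular_automaton G B \<sigma>"
    unfolding cellular_automaton_def
  proof (intro conjI exI[of _ M] exI[of _ \<nu>] ballI)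
    show "\<sigma> \<in> configs G B \<rightarrow> configs G B"
      using FB KA \<tau> by (auto simp: \<sigma>_def)
    show "\<nu> \<in> (M \<rightarrow>\<^sub>E B) \<rightarrow> B"
    proof
      fix p assume "p \<in> M \<rightarrow>\<^sub>E B"
      then have "(\<lambda>m\<in>M. k (p m)) \<in> M \<rightarrow>\<^sub>E A"
        using kA by auto
      then show "\<nu> p \<in> B"
        unfolding \<nu>_def using \<mu> fB by blast
    qed
    fix y g assume y: "y \<in> configs G B" and g: "g \<in> carrier G"
    have "restrict (shift G (inv\<^bsub>G\<^esub> g) (K y)) M
        = (\<lambda>m\<in>M. k (restrict (shift G (inv\<^bsub>G\<^esub> g) y) M m))"
      using M g by (auto simp: shift_def K_def restrict_def fun_eq_iff)
    then show "\<sigma> y g = \<nu> (restrict (shift G (inv\<^bsub>G\<^esub> g) y) M)"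
      using loc[OF KA[OF y] g] g by (simp add: \<sigma>_def F_def \<nu>_def)
  qed (use M in auto)
  moreover have "post_surjective G B \<sigma>"
    unfolding post_surjective_def
  proof (intro ballI impI)
    fix x y assume x: "x \<in> configs G B" and y: "y \<in> configs G B"
      and "asymptotic G y (\<sigma> x)"
    then have "asymptotic G (K y) (\<tau> (K x))"
      using asK[of y "\<sigma> x"] KF[OF \<tau>[OF KA[OF x]]] by (simp add: \<sigma>_def)
    then obtain z where z: "z \<in> configs G A" "asymptotic G z (K x)" "\<tau> z = K y"
      using ps KA[OF x] KA[OF y] unfolding post_surjective_def by blast
    show "\<exists>z\<in>configs G B. asymptotic G z x \<and> \<sigma> z = y"
      using z FB[OF z(1)] asF[OF z(2)] FK[OF x] FK[OF y] KF[OF z(1)]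
      by (intro bexI[of _ "F z"]) (auto simp: \<sigma>_def)
  qed
  ultimately have inj: "pre_injective G B \<sigma>"
    using pi unfolding post_injunctive_def B_def by blast
  show ?thesis
    unfolding pre_injective_def
  proof (intro ballI impI)
    fix x y assume x: "x \<in> configs G A" and y: "y \<in> configs G A"
      and "asymptotic G x y" and "\<tau> x = \<tau> y"
    then have "F x = F y"
      using inj FB[OF x] FB[OF y] asF[of x y] KF[OF x] KF[OF y]
      unfolding pre_injective_def \<sigma>_def by metis
    then show "x = y"
      using KF[OF x] KF[OF y] by metis
  qed
qed

section \<open>The space of normal subgroups\<close>

text \<open>
  The topology induced from the product topology on \<open>{0,1}^G\<close> by the map sending a normal
  subgroup to its indicator function.
\<close>

definition normal_subgroup_topology :: "('g, 'm) monoid_scheme \<Rightarrow> 'g set topology" where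
  "normal_subgroup_topology G =
     pullback_topology {H. H \<lhd> G} (\<lambda>H. restrict (indicator H) (carrier G))
       (product_topology (\<lambda>_. discrete_topology {0, 1 :: nat}) (carrier G))"

lemma topspace_normal_subgroup_topology:
  "topspace (normal_subgroup_topology G) = {H. H \<lhd> G}"
  by (auto simp: normal_subgroup_topology_def topspace_pullback_topology indicator_def)

end

theory Submission
  imports Defs
begin

text \<open>
  The complement is open. Let \<open>\<tau>\<close> be a post-surjective cellular automaton over \<open>G = \<Gamma>/H\<close> that
  is not pre-injective. By compactness post-surjectivity is uniform: there is a finite set \<open>N\<close> such
  that any change of \<open>\<tau> x\<close> at one site \<open>g\<close> is realised by changing \<open>x\<close> inside \<open>g N\<close>. Uniform
  post-surjectivity and the failure of pre-injectivity then only involve the multiplication table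
  of \<open>G\<close> on a finite set, so both pass to the automaton with the same local rule over any group
  \<open>\<Gamma>/K\<close> that has the same table there, in particular for \<open>K\<close> close to \<open>H\<close>.
\<close>

section \<open>Asymptotic configurations\<close>

lemma asymptotic_iff:
  "asymptotic G x y \<longleftrightarrow>
     (\<exists>E. finite E \<and> E \<subseteq> carrier G \<and> (\<forall>g\<in>carrier G - E. x g = y g))"
  unfolding asymptotic_def fun_eq_iff restrict_def by (metis (full_types))

lemma asymptotic_refl: "asymptotic G x x"
  unfolding asymptotic_iff by blast

lemma asymptotic_trans:
  assumes "asymptotic G x y" "asymptotic G y z"
  shows "asymptotic G x z"
proof -
  obtain E F where "finite E" "E \<subseteq> carrier G" "\<forall>g\<in>carrier G - E. x g = y g"
    "finite F" "F \<subseteq> carrier G" "\<forall>g\<in>carrier G - F. y g = z g"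
    using assms unfolding asymptotic_iff by blast
  then show ?thesis
    unfolding asymptotic_iff by (intro exI[of _ "E \<union> F"]) auto
qed

lemma configs_ext:
  assumes "x \<in> configs G A" "y \<in> configs G A" "\<And>g. g \<in> carrier G \<Longrightarrow> x g = y g"
  shows "x = y"
  using assms unfolding configs_def by (rule PiE_ext)

section \<open>Cellular automata as local rules run over a group\<close>

text \<open>
  The map \<open>\<phi>\<close> places the abstract memory set \<open>M\<close> in \<open>G\<close>, so that one local rule \<open>\<mu>\<close> can be run over
  several groups.
\<close>

definition rule_map ::
    "('g, 'm) monoid_scheme \<Rightarrow> 'i set \<Rightarrow> (('i \<Rightarrow> 'c) \<Rightarrow> 'c) \<Rightarrow> ('i \<Rightarrow> 'g) \<Rightarrow> ('g \<Rightarrow> 'c) \<Rightarrow> 'g \<Rightarrow> 'c" where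
  "rule_map G M \<mu> \<phi> x = (\<lambda>g\<in>carrier G. \<mu> (\<lambda>m\<in>M. x (g \<otimes>\<^bsub>G\<^esub> \<phi> m)))"

lemma rule_map_configs:
  assumes "group G" "\<phi> \<in> M \<rightarrow> carrier G" "\<mu> \<in> (M \<rightarrow>\<^sub>E A) \<rightarrow> A" "x \<in> configs G A"
  shows "rule_map G M \<mu> \<phi> x \<in> configs G A"
proof -
  interpret group G by fact
  have "(\<lambda>m\<in>M. x (g \<otimes>\<^bsub>G\<^esub> \<phi> m)) \<in> M \<rightarrow>\<^sub>E A" if "g \<in> carrier G" for g
    using assms that by (auto simp: configs_def PiE_def Pi_def)
  then have "\<mu> (\<lambda>m\<in>M. x (g \<otimes>\<^bsub>G\<^esub> \<phi> m)) \<in> A" if "g \<in> carrier G" for g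
    using that funcset_mem[OF assms(3)] by blast
  then show ?thesis
    by (simp add: rule_map_def configs_def restrict_PiE_iff)
qed

lemma cellular_automaton_rule_map:
  fixes G :: "('g, 'm) monoid_scheme" and A :: "'c set"
  assumes "group G" "finite M" "\<phi> \<in> M \<rightarrow> carrier G" "\<mu> \<in> (M \<rightarrow>\<^sub>E A) \<rightarrow> A"
  shows "cellular_automaton G A (rule_map G M \<mu> \<phi>)"
  unfolding cellular_automaton_def
\<comment> \<open>The memory set is the image of \<open>M\<close>. If \<phi> is not injective, a
  pattern on the image pulls back to a pattern on \<open>M\<close> that is constant on the fibres of
  \<phi>.\<close>
proof (intro conjI exI[of _ "\<phi> ` M"] exI[of _ "\<lambda>p. \<mu> (\<lambda>m\<in>M. p (\<phi> m))"] ballI)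
  interpret group G by fact
  show "rule_map G M \<mu> \<phi> \<in> configs G A \<rightarrow> configs G A"
    using rule_map_configs[OF assms(1,3,4)] by blast
  show "(\<lambda>p. \<mu> (\<lambda>m\<in>M. p (\<phi> m))) \<in> (\<phi> ` M \<rightarrow>\<^sub>E A) \<rightarrow> A"
  proof
    fix p assume "p \<in> \<phi> ` M \<rightarrow>\<^sub>E A"
    then have "(\<lambda>m\<in>M. p (\<phi> m)) \<in> M \<rightarrow>\<^sub>E A"
      by auto
    then show "\<mu> (\<lambda>m\<in>M. p (\<phi> m)) \<in> A"
      using assms(4) by blast
  qed
  fix x :: "'g \<Rightarrow> 'c" and g assume g: "g \<in> carrier G"
  have "(\<lambda>m\<in>M. x (g \<otimes>\<^bsub>G\<^esub> \<phi> m)) = (\<lambda>m\<in>M. restrict (shift G (inv\<^bsub>G\<^esub> g) x) (\<phi> ` M) (\<phi> m))"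
    using g assms(3) by (intro restrict_ext) (auto simp: shift_def)
  then show "rule_map G M \<mu> \<phi> x g = \<mu> (\<lambda>m\<in>M. restrict (shift G (inv\<^bsub>G\<^esub> g) x) (\<phi> ` M) (\<phi> m))"
    using g by (simp add: rule_map_def)
qed (use assms in auto)

text \<open>The configuration x shifted by the inverse of g takes the value of x at g m in the point
  m. Reading it on \<open>M\<close> is therefore reading x on g M.\<close>

lemma cellular_automaton_rule_mapE:
  assumes "group G" "cellular_automaton G A \<tau>"
  obtains M \<mu> where "finite M" "M \<subseteq> carrier G" "\<mu> \<in> (M \<rightarrow>\<^sub>E A) \<rightarrow> A"
    "\<And>x. x \<in> configs G A \<Longrightarrow> \<tau> x = rule_map G M \<mu> id x"
proof -
  interpret group G by fact
  obtain M \<mu> where M: "finite M" "M \<subseteq> carrier G" and \<mu>: "\<mu> \<in> (M \<rightarrow>\<^sub>E A) \<rightarrow> A"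
    and loc: "\<And>x g. x \<in> configs G A \<Longrightarrow> g \<in> carrier G \<Longrightarrow>
                \<tau> x g = \<mu> (restrict (shift G (inv\<^bsub>G\<^esub> g) x) M)"
    and \<tau>: "\<tau> \<in> configs G A \<rightarrow> configs G A"
    using assms(2) unfolding cellular_automaton_def by blast
  have "\<tau> x = rule_map G M \<mu> id x" if x: "x \<in> configs G A" for x
  proof (rule configs_ext)
    show "\<tau> x \<in> configs G A" using \<tau> x by blast
    show "rule_map G M \<mu> id x \<in> configs G A"
      by (rule rule_map_configs) (use x \<mu> M assms in auto)
    fix g assume g: "g \<in> carrier G"
    have "restrict (shift G (inv\<^bsub>G\<^esub> g) x) M = (\<lambda>m\<in>M. x (g \<otimes>\<^bsub>G\<^esub> id m))"
      using g M by (intro restrict_ext) (auto simp: shift_def)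
    then show "\<tau> x g = rule_map G M \<mu> id x g"
      using loc[OF x g] g by (simp add: rule_map_def)
  qed
  then show thesis using that M \<mu> by blast
qed

section \<open>Reduction of post-surjectivity to changes at one site\<close>

text \<open>A finite difference between y and \<tau> x is repaired site by site: each repair leaves
  the rest of the image alone, and the relation of being asymptotic is transitive.\<close>

lemma post_surjective_single_siteI:
  assumes conf: "\<tau> \<in> configs G A \<rightarrow> configs G A"
    and site: "\<And>x g b. \<lbrakk>x \<in> configs G A; g \<in> carrier G; b \<in> A\<rbrakk> \<Longrightarrow>
                \<exists>z\<in>configs G A. asymptotic G z x \<and> \<tau> z = (\<tau> x)(g := b)"
  shows "post_surjective G A \<tau>"
proof -
  have *: "\<exists>z\<in>configs G A. asymptotic G z x \<and> \<tau> z = y"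
    if "finite E" "E \<subseteq> carrier G" "x \<in> configs G A" "y \<in> configs G A"
      "\<forall>g\<in>carrier G - E. y g = \<tau> x g" for E x y
    using that
  proof (induction E arbitrary: y rule: finite_induct)
    case empty
    then have "y = \<tau> x"
      using conf by (intro configs_ext[of y G A]) auto
    then show ?case
      using empty asymptotic_refl by blast
  next
    case (insert e E)
    have \<tau>x: "\<tau> x \<in> configs G A" using conf insert.prems by blast
    \<comment> \<open>Undoing the change at e leaves a difference on \<open>E\<close> only, which
      the induction hypothesis handles. The hypothesis \<open>site\<close> then restores the letter
      \<open>y e\<close>.\<close>
    let ?y = "y(e := \<tau> x e)"
    have "?y \<in> configs G A"
      using insert.prems \<tau>x by (auto simp: configs_def PiE_def extensional_def)
    moreover have "\<forall>g\<in>carrier G - E. ?y g = \<tau> x g"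
      using insert.prems by auto
    ultimately obtain z where z: "z \<in> configs G A" "asymptotic G z x" "\<tau> z = ?y"
      using insert by blast
    have "y e \<in> A"
      using insert.prems by (auto simp: configs_def)
    then obtain w where w: "w \<in> configs G A" "asymptotic G w z" "\<tau> w = (\<tau> z)(e := y e)"
      using site z insert.prems by blast
    then have "\<tau> w = y"
      using z by simp
    then show ?case
      using w z asymptotic_trans by blast
  qed
  then show ?thesis
    unfolding post_surjective_def asymptotic_iff[of G _ "\<tau> _"] by blast
qed

section \<open>Transfer of local changes\<close>

text \<open>A product n (inv m) is a site g with g m = n, so these are the sites whose image can
  feel a change on \<open>N\<close>. The identity is added because the change of the image is
  prescribed there.\<close>

definition core :: "('g, 'm) monoid_scheme \<Rightarrow> 'g set \<Rightarrow> 'g set \<Rightarrow> 'g set" where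
  "core G M N = insert \<one>\<^bsub>G\<^esub> (N <#>\<^bsub>G\<^esub> (m_inv G ` M))"

text \<open>The product of the core with \<open>M\<close> holds every site read when the image is
  evaluated on the core. \<open>N\<close> and the core are included so that injectivity on the
  window also separates their points.\<close>

definition window :: "('g, 'm) monoid_scheme \<Rightarrow> 'g set \<Rightarrow> 'g set \<Rightarrow> 'g set" where
  "window G M N = N \<union> core G M N \<union> (core G M N <#>\<^bsub>G\<^esub> M)"

lemma finite_set_mult: "finite A \<Longrightarrow> finite B \<Longrightarrow> finite (A <#>\<^bsub>G\<^esub> B)"
  by (simp add: set_mult_def)

lemma finite_window: "finite M \<Longrightarrow> finite N \<Longrightarrow> finite (window G M N)"
  by (simp add: window_def core_def finite_set_mult)

lemma window_subset_carrier:
  assumes "group G" "M \<subseteq> carrier G" "N \<subseteq> carrier G"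
  shows "window G M N \<subseteq> carrier G"
proof -
  interpret group G by fact
  have "core G M N \<subseteq> carrier G"
    using assms unfolding core_def set_mult_def by (auto intro!: m_closed)
  then show ?thesis
    using assms unfolding window_def set_mult_def by (auto intro!: m_closed)
qed

text \<open>
  Replacing \<open>x\<close> by \<open>z\<close> on \<open>N\<close> affects the image only on \<^term>\<open>core G M N\<close>, and there the image only
  depends on the values on \<^term>\<open>window G M N\<close>. So the replacement can be carried out in any copy
  of \<open>x\<close> on the window, be it in another group or in another configuration over \<open>G\<close>.
\<close>

lemma local_change_transfer:
  assumes G: "group G" and G': "group G'" and M: "M \<subseteq> carrier G" and N: "N \<subseteq> carrier G"
    and \<phi>: "\<phi> \<in> M \<rightarrow> carrier G'" and \<psi>: "\<psi> \<in> carrier G \<rightarrow> carrier G'"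
    and \<mu>: "\<mu> \<in> (M \<rightarrow>\<^sub>E A) \<rightarrow> A"
    and inj: "inj_on \<psi> (window G M N)"
    and mult: "\<And>g m. \<lbrakk>g \<in> core G M N; m \<in> M\<rbrakk> \<Longrightarrow> \<psi> (g \<otimes>\<^bsub>G\<^esub> m) = \<psi> g \<otimes>\<^bsub>G'\<^esub> \<phi> m"
    and x: "x \<in> configs G A" and z: "z \<in> configs G A" and x': "x' \<in> configs G' A"
    and zx: "\<And>g. g \<in> carrier G - N \<Longrightarrow> z g = x g"
    and x'x: "\<And>g. g \<in> window G M N \<Longrightarrow> x' (\<psi> g) = x g"
    and b: "rule_map G M \<mu> id z = (rule_map G M \<mu> id x)(\<one>\<^bsub>G\<^esub> := b)"
  obtains z' where "z' \<in> configs G' A" "\<And>g. g \<in> carrier G' - \<psi> ` N \<Longrightarrow> z' g = x' g"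
    "\<And>g. g \<in> N \<Longrightarrow> z' (\<psi> g) = z g"
    "rule_map G' M \<mu> \<phi> z' = (rule_map G' M \<mu> \<phi> x')(\<psi> \<one>\<^bsub>G\<^esub> := b)"
proof -
  interpret G: group G by fact
  interpret G': group G' by fact
  let ?W = "window G M N" and ?C = "core G M N"
  have W: "?W \<subseteq> carrier G" by (rule window_subset_carrier[OF G M N])
  have NW: "N \<subseteq> ?W" and CW: "?C \<subseteq> ?W" by (auto simp: window_def)
  have one: "\<one>\<^bsub>G\<^esub> \<in> ?C" by (simp add: core_def)
  have CM: "g \<otimes>\<^bsub>G\<^esub> m \<in> ?W" if "g \<in> ?C" "m \<in> M" for g m
    using that by (auto simp: window_def set_mult_def)
  \<comment> \<open>The new values are transplanted along \<psi>; injectivity on \<open>N\<close>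
    makes the preimage unambiguous.\<close>
  define z' where "z' h = (if h \<in> \<psi> ` N then z (inv_into N \<psi> h) else x' h)" for h
  have injN: "inj_on \<psi> N" using inj NW inj_on_subset by blast
  have z'N: "z' (\<psi> g) = z g" if "g \<in> N" for g
    using that injN by (simp add: z'_def)
  \<comment> \<open>The copy of z is faithful on the whole window: off \<open>N\<close> the
    configuration z coincides with x, whose copy is x', and by injectivity such sites do not land in
    the image of \<open>N\<close>.\<close>
  have z'W: "z' (\<psi> g) = z g" if g: "g \<in> ?W" for g
  proof (cases "g \<in> N")
    case False
    then have "\<psi> g \<notin> \<psi> ` N"
      using inj NW g by (meson inj_on_image_mem_iff)
    then show ?thesis
      using x'x[OF g] zx[of g] g W False by (auto simp: z'_def)
  qed (rule z'N)
  have z'conf: "z' \<in> configs G' A"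
  proof -
    have "z' h \<in> A" if h: "h \<in> carrier G'" for h
    proof (cases "h \<in> \<psi> ` N")
      case True
      then show ?thesis using z'N z N by (auto simp: configs_def)
    next
      case False
      then show ?thesis using x' h by (auto simp: z'_def configs_def)
    qed
    moreover have "z' h = undefined" if "h \<notin> carrier G'" for h
      using that \<psi> N x' by (auto simp: z'_def configs_def PiE_def extensional_def)
    ultimately show ?thesis by (auto simp: configs_def)
  qed
  have rule_eq: "rule_map G' M \<mu> \<phi> u' (\<psi> g) = rule_map G M \<mu> id u g"
    if g: "g \<in> ?C" and u: "\<And>h. h \<in> ?W \<Longrightarrow> u' (\<psi> h) = u h" for g u u'
  proof -
    have "(\<lambda>m\<in>M. u' (\<psi> g \<otimes>\<^bsub>G'\<^esub> \<phi> m)) = (\<lambda>m\<in>M. u (g \<otimes>\<^bsub>G\<^esub> id m))"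
      using mult[OF g] u CM[OF g] by (intro restrict_ext) (metis id_apply)
    then show ?thesis
      using g CW W \<psi> by (auto simp: rule_map_def)
  qed
  have "rule_map G' M \<mu> \<phi> z' h = ((rule_map G' M \<mu> \<phi> x')(\<psi> \<one>\<^bsub>G\<^esub> := b)) h" for h
  proof (cases "h \<in> \<psi> ` ?C")
    case True
    then obtain g where g: "g \<in> ?C" "h = \<psi> g" by blast
    \<comment> \<open>No other site of the core is sent to the place of the prescribed
      change.\<close>
    have eq1: "\<psi> g = \<psi> \<one>\<^bsub>G\<^esub> \<longleftrightarrow> g = \<one>\<^bsub>G\<^esub>"
      using inj_on_eq_iff[OF inj] g one CW by blast
    have "rule_map G' M \<mu> \<phi> z' h = rule_map G M \<mu> id z g"
      using rule_eq[OF g(1), of z' z] z'W g(2) by blast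
    moreover have "rule_map G' M \<mu> \<phi> x' h = rule_map G M \<mu> id x g"
      using rule_eq[OF g(1), of x' x] x'x g(2) by blast
    ultimately show ?thesis
      using b eq1 g(2) by simp
  next
    case False
    have "(\<lambda>m\<in>M. z' (h \<otimes>\<^bsub>G'\<^esub> \<phi> m)) = (\<lambda>m\<in>M. x' (h \<otimes>\<^bsub>G'\<^esub> \<phi> m))" if h: "h \<in> carrier G'"
    proof (intro restrict_ext)
      fix m assume m: "m \<in> M"
      \<comment> \<open>Away from the image of the core, the rule reads no altered site: if h
        \<phi>(m) = \<psi>(n) with n in \<open>N\<close>, then also \<psi>(n) = \<psi>(n (inv m))
        \<phi>(m), and cancelling \<phi>(m) puts h into the image of the core.\<close>
      have "h \<otimes>\<^bsub>G'\<^esub> \<phi> m \<notin> \<psi> ` N"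
      proof
        assume "h \<otimes>\<^bsub>G'\<^esub> \<phi> m \<in> \<psi> ` N"
        then obtain n where n: "n \<in> N" "h \<otimes>\<^bsub>G'\<^esub> \<phi> m = \<psi> n" by blast
        have c: "n \<otimes>\<^bsub>G\<^esub> inv\<^bsub>G\<^esub> m \<in> ?C"
          using n m by (auto simp: core_def set_mult_def)
        have nm: "n \<in> carrier G" "m \<in> carrier G" using n m N M by auto
        then have "(n \<otimes>\<^bsub>G\<^esub> inv\<^bsub>G\<^esub> m) \<otimes>\<^bsub>G\<^esub> m = n"
          by (simp add: G.m_assoc)
        then have "h \<otimes>\<^bsub>G'\<^esub> \<phi> m = \<psi> (n \<otimes>\<^bsub>G\<^esub> inv\<^bsub>G\<^esub> m) \<otimes>\<^bsub>G'\<^esub> \<phi> m"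
          using mult[OF c m] n(2) by simp
        moreover have "\<phi> m \<in> carrier G'" "\<psi> (n \<otimes>\<^bsub>G\<^esub> inv\<^bsub>G\<^esub> m) \<in> carrier G'"
          using \<phi> m \<psi> nm by auto
        ultimately have "h = \<psi> (n \<otimes>\<^bsub>G\<^esub> inv\<^bsub>G\<^esub> m)"
          using h G'.right_cancel by blast
        then show False using c False by blast
      qed
      then show "z' (h \<otimes>\<^bsub>G'\<^esub> \<phi> m) = x' (h \<otimes>\<^bsub>G'\<^esub> \<phi> m)" by (simp add: z'_def)
    qed
    moreover have "h \<noteq> \<psi> \<one>\<^bsub>G\<^esub>" using False one by blast
    ultimately show ?thesis by (auto simp: rule_map_def)
  qed
  then have "rule_map G' M \<mu> \<phi> z' = (rule_map G' M \<mu> \<phi> x')(\<psi> \<one>\<^bsub>G\<^esub> := b)" by blast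
  then show thesis
    using that[of z'] z'conf z'N by (simp add: z'_def)
qed

section \<open>Compactness and uniform post-surjectivity\<close>

lemma openin_cylinder:
  fixes A :: "'c set"
  assumes "finite F"
  shows "openin (product_topology (\<lambda>_. discrete_topology A) I)
           {y \<in> I \<rightarrow>\<^sub>E A. \<forall>i\<in>F \<inter> I. y i = x i}"
proof -
  have "openin (product_topology (\<lambda>_. discrete_topology A) I)
          (PiE I (\<lambda>i. if i \<in> F then A \<inter> {x i} else A))"
    by (rule product_topology_basis) (auto intro: finite_subset[OF _ assms])
  moreover have "PiE I (\<lambda>i. if i \<in> F then A \<inter> {x i} else A) = {y \<in> I \<rightarrow>\<^sub>E A. \<forall>i\<in>F \<inter> I. y i = x i}"
    by (auto simp: PiE_def Pi_def split: if_splits)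
  ultimately show ?thesis by simp
qed

text \<open>For a fixed letter b, the configurations for which a change inside \<open>N\<close>
  suffices form an open set that grows with \<open>N\<close>. These sets cover the compact
  configuration space, so one \<open>N\<close> suffices for b; the union over the finitely many
  letters serves all of them.\<close>

lemma post_surjective_uniform:
  fixes A :: "'c set"
  assumes G: "group G" and fin: "finite A" and M: "finite M" "M \<subseteq> carrier G"
    and \<mu>: "\<mu> \<in> (M \<rightarrow>\<^sub>E A) \<rightarrow> A"
    and ps: "post_surjective G A (rule_map G M \<mu> id)"
  obtains N where "finite N" "N \<subseteq> carrier G"
    "\<And>x b. \<lbrakk>x \<in> configs G A; b \<in> A\<rbrakk> \<Longrightarrow> \<exists>z\<in>configs G A. (\<forall>g\<in>carrier G - N. z g = x g) \<and>
       rule_map G M \<mu> id z = (rule_map G M \<mu> id x)(\<one>\<^bsub>G\<^esub> := b)"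
proof -
  interpret group G by fact
  let ?\<tau> = "rule_map G M \<mu> id"
  let ?T = "product_topology (\<lambda>_. discrete_topology A) (carrier G)"
  define good where "good b N = {x \<in> configs G A. \<exists>z\<in>configs G A.
      (\<forall>g\<in>carrier G - N. z g = x g) \<and> ?\<tau> z = (?\<tau> x)(\<one>\<^bsub>G\<^esub> := b)}" for b N
  have mono: "good b N \<subseteq> good b N'" if "N \<subseteq> N'" for b N N'
    using that unfolding good_def by blast
  have top: "topspace ?T = configs G A" by (simp add: configs_def)
  have "open": "openin ?T (good b N)" if N: "finite N" "N \<subseteq> carrier G" for b N
  proof (subst openin_subopen, intro ballI)
    fix x assume "x \<in> good b N"
    then obtain z where x: "x \<in> configs G A" and z: "z \<in> configs G A"
      "\<And>g. g \<in> carrier G - N \<Longrightarrow> z g = x g" "?\<tau> z = (?\<tau> x)(\<one>\<^bsub>G\<^esub> := b)"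
      unfolding good_def by blast
    let ?W = "window G M N"
    let ?U = "{y \<in> carrier G \<rightarrow>\<^sub>E A. \<forall>i\<in>?W \<inter> carrier G. y i = x i}"
    have "openin ?T ?U"
      using openin_cylinder finite_window M N by blast
    moreover have "x \<in> ?U" using x by (simp add: configs_def)
    moreover have "?U \<subseteq> good b N"
    proof
      fix x' assume x': "x' \<in> ?U"
      \<comment> \<open>Transfer inside \<open>G\<close> itself, with the identity as embedding: the
        witness z for x yields one for every x' that agrees with x on the window.\<close>
      obtain z' where "z' \<in> configs G A" "\<And>g. g \<in> carrier G - id ` N \<Longrightarrow> z' g = x' g"
        "?\<tau> z' = (?\<tau> x')(id \<one>\<^bsub>G\<^esub> := b)"
        by (rule local_change_transfer[OF G G M(2) N(2) _ _ \<mu> _ _ x z(1) _ z(2) _ z(3),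
              of id id x'])
          (use M x' window_subset_carrier[OF G M(2) N(2)] in \<open>auto simp: configs_def\<close>)
      then show "x' \<in> good b N"
        using x' by (auto simp: good_def configs_def)
    qed
    ultimately show "\<exists>U. openin ?T U \<and> x \<in> U \<and> U \<subseteq> good b N" by blast
  qed
  have "\<exists>N. finite N \<and> N \<subseteq> carrier G \<and> configs G A \<subseteq> good b N" if b: "b \<in> A" for b
  proof -
    let ?\<N> = "{N. finite N \<and> N \<subseteq> carrier G}"
    have cover: "configs G A \<subseteq> \<Union> (good b ` ?\<N>)"
    proof
      fix x assume x: "x \<in> configs G A"
      let ?y = "(?\<tau> x)(\<one>\<^bsub>G\<^esub> := b)"
      have "?\<tau> x \<in> configs G A"
        by (rule rule_map_configs[OF G _ \<mu> x]) (use M in auto)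
      then have "?y \<in> configs G A"
        using b by (auto simp: configs_def PiE_def extensional_def)
      moreover have "asymptotic G ?y (?\<tau> x)"
        unfolding asymptotic_iff by (intro exI[of _ "{\<one>\<^bsub>G\<^esub>}"]) auto
      \<comment> \<open>Here the finite set on which z and x differ still depends on x.\<close>
      ultimately obtain z where "z \<in> configs G A" "asymptotic G z x" "?\<tau> z = ?y"
        using ps x unfolding post_surjective_def by blast
      then show "x \<in> \<Union> (good b ` ?\<N>)"
        using x unfolding asymptotic_iff good_def by blast
    qed
    have "compact_space ?T"
      using fin by (simp add: compact_space_product_topology compact_space_discrete_topology)
    then have "compactin ?T (configs G A)"
      unfolding compact_space_def top .
    then obtain \<F> where \<F>: "finite \<F>" "\<F> \<subseteq> good b ` ?\<N>" "configs G A \<subseteq> \<Union>\<F>"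
      using compactinD[of ?T "configs G A" "good b ` ?\<N>", OF _ _ cover] "open" by blast
    then obtain \<M> where \<M>: "finite \<M>" "\<M> \<subseteq> ?\<N>" "\<F> = good b ` \<M>"
      using finite_subset_image[OF \<F>(1,2)] by blast
    \<comment> \<open>By monotonicity the finite subcover collapses to a single member.\<close>
    have "configs G A \<subseteq> good b (\<Union>\<M>)"
      using \<F>(3) \<M>(3) mono[of _ "\<Union>\<M>" b] by blast
    then show ?thesis
      using \<M> by (intro exI[of _ "\<Union>\<M>"]) auto
  qed
  then obtain N where N: "\<And>b. b \<in> A \<Longrightarrow> finite (N b) \<and> N b \<subseteq> carrier G \<and> configs G A \<subseteq> good b (N b)"
    by metis
  have "configs G A \<subseteq> good b (\<Union> (N ` A))" if "b \<in> A" for b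
    using N[OF that] mono[of "N b" "\<Union> (N ` A)" b] that by blast
  then show thesis
    using that[of "\<Union> (N ` A)"] N fin unfolding good_def by blast
qed

section \<open>Counterexamples over locally embedded groups\<close>

text \<open>A counterexample over \<open>G\<close> rests on finite data: the memory set
  \<open>M\<close>, the uniform set \<open>N\<close>, and the set \<open>D\<close> on which two
  configurations with equal image differ. The set \<open>W\<close> is built from these alone, hence
  serves every \<open>G'\<close>.\<close>

lemma not_post_injunctive_local_embedding:
  fixes G :: "('g, 'm) monoid_scheme"
  assumes G: "group G" and npi: "\<not> post_injunctive G"
  obtains W where "finite W" "W \<subseteq> carrier G"
    "\<And>(G' :: ('h, 'n) monoid_scheme) \<phi>. \<lbrakk>group G'; \<phi> \<in> carrier G \<rightarrow> carrier G'; inj_on \<phi> W;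
       \<And>g h. \<lbrakk>g \<in> W; h \<in> W\<rbrakk> \<Longrightarrow> \<phi> (g \<otimes>\<^bsub>G\<^esub> h) = \<phi> g \<otimes>\<^bsub>G'\<^esub> \<phi> h\<rbrakk> \<Longrightarrow> \<not> post_injunctive G'"
proof -
  interpret G: group G by fact
  obtain A :: "nat set" and \<sigma> where fin: "finite A" and ca: "cellular_automaton G A \<sigma>"
    and ps\<sigma>: "post_surjective G A \<sigma>" and npre: "\<not> pre_injective G A \<sigma>"
    using npi unfolding post_injunctive_def by blast
  obtain M \<mu> where M: "finite M" "M \<subseteq> carrier G" and \<mu>: "\<mu> \<in> (M \<rightarrow>\<^sub>E A) \<rightarrow> A"
    and \<sigma>: "\<And>x. x \<in> configs G A \<Longrightarrow> \<sigma> x = rule_map G M \<mu> id x"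
    by (rule cellular_automaton_rule_mapE[OF G ca]) blast
  let ?\<tau> = "rule_map G M \<mu> id"
  have ps: "post_surjective G A ?\<tau>"
    using ps\<sigma> \<sigma> unfolding post_surjective_def by metis
  obtain N where N: "finite N" "N \<subseteq> carrier G"
    and unif: "\<And>x b. \<lbrakk>x \<in> configs G A; b \<in> A\<rbrakk> \<Longrightarrow> \<exists>z\<in>configs G A.
                 (\<forall>g\<in>carrier G - N. z g = x g) \<and> ?\<tau> z = (?\<tau> x)(\<one>\<^bsub>G\<^esub> := b)"
    by (rule post_surjective_uniform[OF G fin M \<mu> ps]) blast
  obtain p q where p: "p \<in> configs G A" and q: "q \<in> configs G A" and "asymptotic G q p"
    and pq: "?\<tau> q = ?\<tau> p" "p \<noteq> q"
    using npre \<sigma> unfolding pre_injective_def by metis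
  then obtain D where D: "finite D" "D \<subseteq> carrier G" "\<And>g. g \<in> carrier G - D \<Longrightarrow> q g = p g"
    unfolding asymptotic_iff by blast
  \<comment> \<open>The first window carries post-surjectivity, the second the failure of
    pre-injectivity; \<open>M\<close> is added so that products of core sites with memory sites are
    preserved.\<close>
  define W where "W = window G M N \<union> window G M D \<union> M"
  have W: "finite W" "W \<subseteq> carrier G"
    unfolding W_def using finite_window M N D window_subset_carrier[OF G M(2)] by auto
  have oneW: "\<one>\<^bsub>G\<^esub> \<in> W" by (simp add: W_def window_def core_def)
  have coreW: "core G M N \<subseteq> W" "core G M D \<subseteq> W" by (auto simp: W_def window_def)
  have winW: "window G M N \<subseteq> W" "window G M D \<subseteq> W" "M \<subseteq> W" by (auto simp: W_def)
  have "\<not> post_injunctive G'"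
    if G': "group G'" and \<phi>: "\<phi> \<in> carrier G \<rightarrow> carrier G'" and inj: "inj_on \<phi> W"
      and mult: "\<And>g h. \<lbrakk>g \<in> W; h \<in> W\<rbrakk> \<Longrightarrow> \<phi> (g \<otimes>\<^bsub>G\<^esub> h) = \<phi> g \<otimes>\<^bsub>G'\<^esub> \<phi> h"
    for G' :: "('h, 'n) monoid_scheme" and \<phi>
  proof -
    interpret G': group G' by fact
    let ?\<tau>' = "rule_map G' M \<mu> \<phi>"
    have \<phi>M: "\<phi> \<in> M \<rightarrow> carrier G'" using \<phi> M by auto
    \<comment> \<open>An idempotent of a group is the identity.\<close>
    have "\<phi> \<one>\<^bsub>G\<^esub> \<otimes>\<^bsub>G'\<^esub> \<phi> \<one>\<^bsub>G\<^esub> = \<phi> \<one>\<^bsub>G\<^esub>"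
      using mult[OF oneW oneW] by simp
    then have \<phi>1: "\<phi> \<one>\<^bsub>G\<^esub> = \<one>\<^bsub>G'\<^esub>"
      using \<phi> by (metis G'.l_cancel_one G.one_closed PiE)
    have ca': "cellular_automaton G' A ?\<tau>'"
      by (rule cellular_automaton_rule_map[OF G' M(1) \<phi>M \<mu>])
    have ps': "post_surjective G' A ?\<tau>'"
    proof (rule post_surjective_single_siteI)
      show "?\<tau>' \<in> configs G' A \<rightarrow> configs G' A"
        using ca' by (simp add: cellular_automaton_def)
      fix x' g0 b assume x': "x' \<in> configs G' A" and g0: "g0 \<in> carrier G'" and b: "b \<in> A"
      \<comment> \<open>Uniformity is known only at the identity. Translating \<phi> on the left by
        \<open>g0\<close> moves the change to \<open>g0\<close> and keeps compatibility with right
        multiplication by the memory set.\<close>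
      define \<psi> where "\<psi> g = g0 \<otimes>\<^bsub>G'\<^esub> \<phi> g" for g
      define x where "x = (\<lambda>g\<in>carrier G. x' (\<psi> g))"
      have \<psi>: "\<psi> \<in> carrier G \<rightarrow> carrier G'" using \<phi> g0 by (auto simp: \<psi>_def intro!: G'.m_closed)
      have inj\<psi>: "inj_on \<psi> W"
        using inj \<phi> g0 W by (auto simp: \<psi>_def inj_on_def Pi_def subset_iff)
      have x: "x \<in> configs G A" using x' \<psi> by (auto simp: x_def configs_def)
      obtain z where z: "z \<in> configs G A" "\<And>g. g \<in> carrier G - N \<Longrightarrow> z g = x g"
        "?\<tau> z = (?\<tau> x)(\<one>\<^bsub>G\<^esub> := b)"
        using unif[OF x b] by blast
      have inj_window: "inj_on \<psi> (window G M N)"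
        using inj\<psi> winW inj_on_subset by blast
      have mult\<psi>: "\<psi> (g \<otimes>\<^bsub>G\<^esub> m) = \<psi> g \<otimes>\<^bsub>G'\<^esub> \<phi> m" if "g \<in> core G M N" "m \<in> M" for g m
      proof -
        have "g \<in> W" "m \<in> W" using that coreW winW by auto
        moreover from this have "\<phi> g \<in> carrier G'" "\<phi> m \<in> carrier G'" using W \<phi> by auto
        ultimately show ?thesis using g0 by (simp add: \<psi>_def mult G'.m_assoc)
      qed
      have x'x: "x' (\<psi> g) = x g" if "g \<in> window G M N" for g
        using that winW W by (auto simp: x_def)
      obtain z' where z': "z' \<in> configs G' A" "\<forall>g\<in>carrier G' - \<psi> ` N. z' g = x' g"
        "?\<tau>' z' = (?\<tau>' x')(\<psi> \<one>\<^bsub>G\<^esub> := b)"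
        by (rule local_change_transfer[OF G G' M(2) N(2) \<phi>M \<psi> \<mu> inj_window mult\<psi> x z(1) x' z(2)
              x'x z(3)]) blast+
      have "asymptotic G' z' x'"
        unfolding asymptotic_iff using z'(2) N \<psi> by (intro exI[of _ "\<psi> ` N"]) auto
      moreover have "\<psi> \<one>\<^bsub>G\<^esub> = g0" using g0 by (simp add: \<psi>_def \<phi>1)
      ultimately show "\<exists>z\<in>configs G' A. asymptotic G' z x' \<and> ?\<tau>' z = (?\<tau>' x')(g0 := b)"
        using z' by auto
    qed
    have "\<not> pre_injective G' A ?\<tau>'"
    proof -
      \<comment> \<open>A copy of p on the image of \<open>W\<close>. Elsewhere any letter of
        \<open>A\<close> would do, and the value of p at the identity is one.\<close>
      define p' where "p' = (\<lambda>h\<in>carrier G'. if h \<in> \<phi> ` W then p (inv_into W \<phi> h) else p \<one>\<^bsub>G\<^esub>)"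
      have p'W: "p' (\<phi> g) = p g" if "g \<in> W" for g
        using that inj \<phi> W by (auto simp: p'_def)
      have p': "p' \<in> configs G' A"
      proof -
        have "p (inv_into W \<phi> h) \<in> A" if "h \<in> \<phi> ` W" for h
          using that p W inv_into_into[OF that] by (auto simp: configs_def)
        then show ?thesis
          using p by (auto simp: p'_def configs_def)
      qed
      have inj_window: "inj_on \<phi> (window G M D)"
        using inj winW inj_on_subset by blast
      have mult\<phi>: "\<phi> (g \<otimes>\<^bsub>G\<^esub> m) = \<phi> g \<otimes>\<^bsub>G'\<^esub> \<phi> m" if "g \<in> core G M D" "m \<in> M" for g m
        using that coreW winW mult by blast
      have p'p: "p' (\<phi> g) = p g" if "g \<in> window G M D" for g
        using that winW p'W by blast
      \<comment> \<open>Equality of the two images is phrased as a trivial update at the identity,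
        so that the transfer lemma applies.\<close>
      have upd: "?\<tau> q = (?\<tau> p)(\<one>\<^bsub>G\<^esub> := ?\<tau> p \<one>\<^bsub>G\<^esub>)"
        using pq by simp
      obtain q' where q': "q' \<in> configs G' A" "\<forall>g\<in>carrier G' - \<phi> ` D. q' g = p' g"
        "\<forall>g\<in>D. q' (\<phi> g) = q g" "?\<tau>' q' = (?\<tau>' p')(\<phi> \<one>\<^bsub>G\<^esub> := ?\<tau> p \<one>\<^bsub>G\<^esub>)"
        by (rule local_change_transfer[OF G G' M(2) D(2) \<phi>M \<phi> \<mu> inj_window mult\<phi> p q p' D(3)
              p'p upd]) blast+
      \<comment> \<open>The transferred update is trivial as well: the image of p' at the identity
        depends only on the copy of p on \<open>M\<close>.\<close>
      have "?\<tau>' p' (\<phi> \<one>\<^bsub>G\<^esub>) = ?\<tau> p \<one>\<^bsub>G\<^esub>"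
      proof -
        have "(\<lambda>m\<in>M. p' (\<one>\<^bsub>G'\<^esub> \<otimes>\<^bsub>G'\<^esub> \<phi> m)) = (\<lambda>m\<in>M. p (\<one>\<^bsub>G\<^esub> \<otimes>\<^bsub>G\<^esub> id m))"
          using \<phi>M M winW p'W by (intro restrict_ext) (auto simp: Pi_def subset_iff)
        then show ?thesis by (simp add: rule_map_def \<phi>1)
      qed
      then have "?\<tau>' q' = ?\<tau>' p'"
        using q'(4) by (metis fun_upd_triv)
      moreover have "asymptotic G' q' p'"
        unfolding asymptotic_iff using q'(2) D \<phi> by (intro exI[of _ "\<phi> ` D"]) auto
      \<comment> \<open>On the image of \<open>D\<close> the two configurations are copies of q and
        p, which differ somewhere on \<open>D\<close>.\<close>
      moreover have "q' \<noteq> p'"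
      proof
        assume eq: "q' = p'"
        have "D \<subseteq> W" by (auto simp: W_def window_def)
        then have "q g = p g" if "g \<in> D" for g
          using q'(3) p'W that eq by force
        then have "q = p"
          using D(3) by (intro configs_ext[OF q p]) blast
        then show False using pq by simp
      qed
      ultimately show ?thesis
        unfolding pre_injective_def using q'(1) p' by blast
    qed
    then show ?thesis
      unfolding post_injunctive_def using fin ca' ps' by blast
  qed
  then show thesis using that W by blast
qed

section \<open>Neighbourhoods of a normal subgroup and nearby quotients\<close>

text \<open>Agreement on \<open>E\<close> constrains finitely many coordinates of the indicator
  function, so the set is the preimage of a cylinder.\<close>

lemma openin_normal_subgroup_topology:
  assumes "finite E" "E \<subseteq> carrier G"
  shows "openin (normal_subgroup_topology G) {K. K \<lhd> G \<and> K \<inter> E = H \<inter> E}"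
  unfolding normal_subgroup_topology_def openin_pullback_topology
proof (intro exI conjI)
  let ?U = "{y \<in> carrier G \<rightarrow>\<^sub>E {0, 1 :: nat}. \<forall>i\<in>E \<inter> carrier G. y i = indicator H i}"
  show "openin (product_topology (\<lambda>_. discrete_topology {0, 1}) (carrier G)) ?U"
    using openin_cylinder[OF assms(1)] .
  have "(\<forall>i\<in>E. (indicator K i :: nat) = indicator H i) \<longleftrightarrow> K \<inter> E = H \<inter> E" for K
    by (auto simp: indicator_def split: if_splits)
  moreover have "(\<lambda>i\<in>carrier G. indicator K i) \<in> ?U \<longleftrightarrow>
      (\<forall>i\<in>E. (indicator K i :: nat) = indicator H i)" for K
    using assms(2) by (auto simp: indicator_def)
  ultimately show "{K. K \<lhd> G \<and> K \<inter> E = H \<inter> E} =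
      (\<lambda>K. restrict (indicator K) (carrier G)) -` ?U \<inter> {H. H \<lhd> G}"
    by auto
qed

text \<open>With fixed representatives, a coset of \<open>H\<close> is sent to the
  \<open>K\<close>-coset of its representative. Injectivity and multiplicativity on \<open>W\<close>
  then follow from the membership in \<open>K\<close> of finitely many elements being the same as in
  \<open>H\<close>; these elements form \<open>E\<close>.\<close>

lemma quotient_local_embedding:
  fixes G :: "('g, 'm) monoid_scheme"
  assumes H: "H \<lhd> G" and W: "finite W" "W \<subseteq> carrier (G Mod H)"
  obtains E where "finite E" "E \<subseteq> carrier G"
    "\<And>K. \<lbrakk>K \<lhd> G; K \<inter> E = H \<inter> E\<rbrakk> \<Longrightarrow> \<exists>\<phi>\<in>carrier (G Mod H) \<rightarrow> carrier (G Mod K).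
       inj_on \<phi> W \<and>
       (\<forall>C\<in>W. \<forall>D\<in>W. \<phi> (C \<otimes>\<^bsub>G Mod H\<^esub> D) = \<phi> C \<otimes>\<^bsub>G Mod K\<^esub> \<phi> D)"
proof -
  interpret H: normal H G by fact
  define s where "s C = (SOME g. g \<in> carrier G \<and> C = H #>\<^bsub>G\<^esub> g)" for C
  have s: "s C \<in> carrier G" "H #>\<^bsub>G\<^esub> s C = C" if "C \<in> carrier (G Mod H)" for C
  proof -
    have "\<exists>g. g \<in> carrier G \<and> C = H #>\<^bsub>G\<^esub> g"
      using that by (auto simp: FactGroup_def RCOSETS_def)
    from someI_ex[OF this] show "s C \<in> carrier G" "H #>\<^bsub>G\<^esub> s C = C"
      by (auto simp: s_def)
  qed
  have mod: "C \<otimes>\<^bsub>G Mod H\<^esub> D \<in> carrier (G Mod H)"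
    if "C \<in> carrier (G Mod H)" "D \<in> carrier (G Mod H)" for C D
    using group.is_monoid[OF H.factorgroup_is_group] that by (rule monoid.m_closed)
  have coset_eq: "L #>\<^bsub>G\<^esub> a = L #>\<^bsub>G\<^esub> b \<longleftrightarrow> a \<otimes>\<^bsub>G\<^esub> inv\<^bsub>G\<^esub> b \<in> L"
    if "L \<lhd> G" "a \<in> carrier G" "b \<in> carrier G" for L a b
  proof -
    interpret L: normal L G by fact
    show ?thesis
      using that L.rcos_module[OF H.is_group, of b a] H.rcos_self[of a L]
        H.repr_independence[of a L b] L.subgroup_axioms by metis
  qed
  \<comment> \<open>For cosets C and D of \<open>H\<close>, \<open>e C D\<close> lies in
    \<open>H\<close> exactly if C = D, and \<open>f C D\<close> always lies in \<open>H\<close>, as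
    it compares the representative of a product with the product of representatives. The same
    memberships in \<open>K\<close> give injectivity and multiplicativity.\<close>
  define e where "e C D = s C \<otimes>\<^bsub>G\<^esub> inv\<^bsub>G\<^esub> (s D)" for C D
  define f where "f C D = s (C \<otimes>\<^bsub>G Mod H\<^esub> D) \<otimes>\<^bsub>G\<^esub> inv\<^bsub>G\<^esub> (s C \<otimes>\<^bsub>G\<^esub> s D)" for C D
  define E where "E = case_prod e ` (W \<times> W) \<union> case_prod f ` (W \<times> W)"
  have E: "e C D \<in> E" "f C D \<in> E" if "C \<in> W" "D \<in> W" for C D
    using that by (auto simp: E_def)
  show thesis
  proof (rule that[of E])
    show "finite E" using W by (simp add: E_def)
    show "E \<subseteq> carrier G"
      using W s(1) mod unfolding E_def e_def f_def
      by (auto simp del: mult_FactGroup intro!: H.m_closed H.inv_closed s(1) mod)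
    fix K assume K: "K \<lhd> G" and KE: "K \<inter> E = H \<inter> E"
    interpret K: normal K G by fact
    define \<phi> where "\<phi> C = K #>\<^bsub>G\<^esub> s C" for C
    have "inj_on \<phi> W"
    proof (rule inj_onI)
      fix C D assume CD: "C \<in> W" "D \<in> W" "\<phi> C = \<phi> D"
      then have C: "C \<in> carrier (G Mod H)" "D \<in> carrier (G Mod H)" using W by auto
      have "e C D \<in> K"
        using CD(3) coset_eq[OF K s(1)[OF C(1)] s(1)[OF C(2)]] by (simp add: \<phi>_def e_def)
      then have "e C D \<in> H" using KE E CD by blast
      then show "C = D"
        using coset_eq[OF H s(1)[OF C(1)] s(1)[OF C(2)]] s(2) C by (simp add: e_def)
    qed
    moreover have "\<phi> (C \<otimes>\<^bsub>G Mod H\<^esub> D) = \<phi> C \<otimes>\<^bsub>G Mod K\<^esub> \<phi> D" if CD: "C \<in> W" "D \<in> W" for C D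
    proof -
      have C: "C \<in> carrier (G Mod H)" "D \<in> carrier (G Mod H)" using W CD by auto
      note sC = s(1)[OF C(1)] s(1)[OF C(2)]
      have "H #>\<^bsub>G\<^esub> (s C \<otimes>\<^bsub>G\<^esub> s D) = C \<otimes>\<^bsub>G Mod H\<^esub> D"
        using H.rcos_sum[OF sC] s(2)[OF C(1)] s(2)[OF C(2)] by simp
      then have "f C D \<in> H"
        using coset_eq[OF H s(1)[OF mod[OF C]], of "s C \<otimes>\<^bsub>G\<^esub> s D"] s(2)[OF mod[OF C]] sC
        by (simp add: f_def)
      then have "f C D \<in> K" using KE E CD by blast
      then have "\<phi> (C \<otimes>\<^bsub>G Mod H\<^esub> D) = K #>\<^bsub>G\<^esub> (s C \<otimes>\<^bsub>G\<^esub> s D)"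
        using coset_eq[OF K s(1)[OF mod[OF C]], of "s C \<otimes>\<^bsub>G\<^esub> s D"] sC
        by (simp add: \<phi>_def f_def)
      then show ?thesis
        using K.rcos_sum[OF sC] by (simp add: \<phi>_def)
    qed
    moreover have "\<phi> \<in> carrier (G Mod H) \<rightarrow> carrier (G Mod K)"
    proof
      fix C assume "C \<in> carrier (G Mod H)"
      then show "\<phi> C \<in> carrier (G Mod K)"
        using s(1)[of C] by (auto simp: \<phi>_def FactGroup_def RCOSETS_def)
    qed
    ultimately show "\<exists>\<phi>\<in>carrier (G Mod H) \<rightarrow> carrier (G Mod K). inj_on \<phi> W \<and>
       (\<forall>C\<in>W. \<forall>D\<in>W. \<phi> (C \<otimes>\<^bsub>G Mod H\<^esub> D) = \<phi> C \<otimes>\<^bsub>G Mod K\<^esub> \<phi> D)"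
      by blast
  qed
qed

section \<open>Closedness of the set of post-injunctive quotients\<close>

theorem theorem8p1:
  fixes \<Gamma> :: "('g, 'm) monoid_scheme"
  assumes "group \<Gamma>"
  shows "closedin (normal_subgroup_topology \<Gamma>) {H. H \<lhd> \<Gamma> \<and> post_injunctive (\<Gamma> Mod H)}"
  unfolding closedin_def topspace_normal_subgroup_topology
proof (intro conjI)
  have "\<exists>U. openin (normal_subgroup_topology \<Gamma>) U \<and> H \<in> U \<and>
      U \<subseteq> {H. H \<lhd> \<Gamma> \<and> \<not> post_injunctive (\<Gamma> Mod H)}"
    if H: "H \<lhd> \<Gamma>" and npi: "\<not> post_injunctive (\<Gamma> Mod H)" for H
  proof -
    obtain W where W: "finite W" "W \<subseteq> carrier (\<Gamma> Mod H)"
      and emb: "\<And>(G' :: 'g set monoid) \<phi>. \<lbrakk>group G'; \<phi> \<in> carrier (\<Gamma> Mod H) \<rightarrow> carrier G';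
        inj_on \<phi> W; \<And>g h. \<lbrakk>g \<in> W; h \<in> W\<rbrakk> \<Longrightarrow> \<phi> (g \<otimes>\<^bsub>\<Gamma> Mod H\<^esub> h) = \<phi> g \<otimes>\<^bsub>G'\<^esub> \<phi> h\<rbrakk>
        \<Longrightarrow> \<not> post_injunctive G'"
      using not_post_injunctive_local_embedding[OF normal.factorgroup_is_group[OF H] npi]
      by metis
    obtain E where E: "finite E" "E \<subseteq> carrier \<Gamma>"
      and \<phi>: "\<And>K. \<lbrakk>K \<lhd> \<Gamma>; K \<inter> E = H \<inter> E\<rbrakk> \<Longrightarrow>
        \<exists>\<phi>\<in>carrier (\<Gamma> Mod H) \<rightarrow> carrier (\<Gamma> Mod K). inj_on \<phi> W \<and>
          (\<forall>C\<in>W. \<forall>D\<in>W. \<phi> (C \<otimes>\<^bsub>\<Gamma> Mod H\<^esub> D) = \<phi> C \<otimes>\<^bsub>\<Gamma> Mod K\<^esub> \<phi> D)"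
      by (rule quotient_local_embedding[OF H W]) blast
    \<comment> \<open>For K in this basic neighbourhood of H, the quotient by K contains a copy of
      the multiplication of the quotient by H on \<open>W\<close>, so the counterexample
      persists.\<close>
    have "\<not> post_injunctive (\<Gamma> Mod K)" if K: "K \<lhd> \<Gamma>" "K \<inter> E = H \<inter> E" for K
      using \<phi>[OF K] emb[OF normal.factorgroup_is_group[OF K(1)]] by blast
    then show ?thesis
      using openin_normal_subgroup_topology[OF E, of H] H
      by (intro exI[of _ "{K. K \<lhd> \<Gamma> \<and> K \<inter> E = H \<inter> E}"]) auto
  qed
  then have "openin (normal_subgroup_topology \<Gamma>) {H. H \<lhd> \<Gamma> \<and> \<not> post_injunctive (\<Gamma> Mod H)}"
    by (subst openin_subopen) blast
  moreover have "{H. H \<lhd> \<Gamma>} - {H. H \<lhd> \<Gamma> \<and> post_injunctive (\<Gamma> Mod H)} =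
      {H. H \<lhd> \<Gamma> \<and> \<not> post_injunctive (\<Gamma> Mod H)}"
    by blast
  ultimately show "openin (normal_subgroup_topology \<Gamma>)
      ({H. H \<lhd> \<Gamma>} - {H. H \<lhd> \<Gamma> \<and> post_injunctive (\<Gamma> Mod H)})"
    by simp
qed blast

end
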